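(* Let $N\geq 2$ and $1\leq k<N$ be integers. Let $g:[0,+\infty)\to\mathbb R$ be twice differentiable on $(0,+\infty)$ and such that $$g''(s)-\frac 1 s g'(s)\geq 0\quad \text{for all } s>0.$$ Then the solution of the Cauchy problem $$\partial_t u=\mathcal P_k^- u \ \text{ in } (0,+\infty)\times\mathbb R^N,\qquad u(0,x)=u_0(x):=g(\vert x\vert),$$ is $$u(t,x)=g\left(\sqrt{2kt+\vert x\vert^2}\right),\quad t\geq 0,\ x\in\mathbb R^N.$$
   Context: For a function $u:\mathbb R^N\to\mathbb R$ (of class $C^2$, or in the viscosity sense), let $\lambda_1(D^2u)\leq\cdots\leq\lambda_N(D^2u)$ denote the eigenvalues of the Hessian matrix $D^2u$, and define the fully nonlinear degenerate elliptic operator $\mathcal P_k^- u:=\sum_{i=1}^k\lambda_i(D^2u)$ (sum of the $k$ smallest eigenvalues). Solutions of the Cauchy problem are understood in the viscosity sense; $\vert x\vert$ is the Euclidean norm. *)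

theory Defs
  imports "HOL-Analysis.Analysis" "HOL-Library.Multiset"
begin

text \<open>Eigenvalues (with multiplicity) of a real symmetric matrix. For symmetric
  matrices algebraic and geometric multiplicities coincide, so the multiplicity of an
  eigenvalue is the dimension of its eigenspace.\<close>
definition eigenspace :: "real^'n^'n \<Rightarrow> real \<Rightarrow> (real^'n) set" where
  "eigenspace A l = {v. A *v v = l *\<^sub>R v}"

definition eigvals_mset :: "real^'n^'n \<Rightarrow> real multiset" where
  "eigvals_mset A =
     (\<Sum>l\<in>{l. \<exists>v. v \<noteq> 0 \<and> A *v v = l *\<^sub>R v}. replicate_mset (dim (eigenspace A l)) l)"

text \<open>lambda_1 <= ... <= lambda_N : the sorted list of eigenvalues\<close>
definition eigvals_sorted :: "real^'n^'n \<Rightarrow> real list" where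
  "eigvals_sorted A = sorted_list_of_multiset (eigvals_mset A)"

text \<open>Pucci-type operator P_k^- : sum of the k smallest eigenvalues\<close>
definition Pk_minus :: "nat \<Rightarrow> real^'n^'n \<Rightarrow> real" where
  "Pk_minus k A = sum_list (take k (eigvals_sorted A))"

text \<open>The parabolic domain (0,+infinity) x R^N.\<close>
definition pdom :: "(real \<times> (real^'n)) set" where
  "pdom = {(t, x). t > 0}"

text \<open>phi is a C^{1,2} test function on (0,+infinity) x R^N with time derivative phit,
  spatial gradient Dphi and spatial Hessian D2phi (all jointly continuous).\<close>
definition C12_test ::
  "(real \<Rightarrow> real^'n \<Rightarrow> real) \<Rightarrow> (real \<Rightarrow> real^'n \<Rightarrow> real) \<Rightarrow>
   (real \<Rightarrow> real^'n \<Rightarrow> real^'n) \<Rightarrow> (real \<Rightarrow> real^'n \<Rightarrow> real^'n^'n) \<Rightarrow> bool" where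
  "C12_test phi phit Dphi D2phi \<longleftrightarrow>
     (\<forall>t x. t > 0 \<longrightarrow>
        ((\<lambda>s. phi s x) has_real_derivative phit t x) (at t) \<and>
        ((\<lambda>y. phi t y) has_derivative (\<lambda>h. Dphi t x \<bullet> h)) (at x) \<and>
        ((\<lambda>y. Dphi t y) has_derivative (\<lambda>h. D2phi t x *v h)) (at x)) \<and>
     continuous_on pdom (\<lambda>(t, x). phi t x) \<and>
     continuous_on pdom (\<lambda>(t, x). phit t x) \<and>
     continuous_on pdom (\<lambda>(t, x). Dphi t x) \<and>
     continuous_on pdom (\<lambda>(t, x). D2phi t x)"

definition local_max_at :: "(real \<Rightarrow> real^'n \<Rightarrow> real) \<Rightarrow> real \<Rightarrow> real^'n \<Rightarrow> bool" where
  "local_max_at w t0 x0 \<longleftrightarrow>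
     (\<exists>e>0. \<forall>s y. s > 0 \<and> \<bar>s - t0\<bar> < e \<and> dist y x0 < e \<longrightarrow> w s y \<le> w t0 x0)"

definition local_min_at :: "(real \<Rightarrow> real^'n \<Rightarrow> real) \<Rightarrow> real \<Rightarrow> real^'n \<Rightarrow> bool" where
  "local_min_at w t0 x0 \<longleftrightarrow>
     (\<exists>e>0. \<forall>s y. s > 0 \<and> \<bar>s - t0\<bar> < e \<and> dist y x0 < e \<longrightarrow> w s y \<ge> w t0 x0)"

text \<open>Viscosity solution of  u_t = P_k^- u  in (0,+infinity) x R^N.\<close>
definition viscosity_subsolution :: "nat \<Rightarrow> (real \<Rightarrow> real^'n \<Rightarrow> real) \<Rightarrow> bool" where
  "viscosity_subsolution k u \<longleftrightarrow>
     (\<forall>t0 x0 phi phit Dphi D2phi. t0 > 0 \<and> C12_test phi phit Dphi D2phi \<and>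
        local_max_at (\<lambda>s y. u s y - phi s y) t0 x0 \<longrightarrow>
        phit t0 x0 \<le> Pk_minus k (D2phi t0 x0))"

definition viscosity_supersolution :: "nat \<Rightarrow> (real \<Rightarrow> real^'n \<Rightarrow> real) \<Rightarrow> bool" where
  "viscosity_supersolution k u \<longleftrightarrow>
     (\<forall>t0 x0 phi phit Dphi D2phi. t0 > 0 \<and> C12_test phi phit Dphi D2phi \<and>
        local_min_at (\<lambda>s y. u s y - phi s y) t0 x0 \<longrightarrow>
        phit t0 x0 \<ge> Pk_minus k (D2phi t0 x0))"

definition viscosity_solution :: "nat \<Rightarrow> (real \<Rightarrow> real^'n \<Rightarrow> real) \<Rightarrow> bool" where
  "viscosity_solution k u \<longleftrightarrow>
     continuous_on pdom (\<lambda>(t, x). u t x) \<and>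
     viscosity_subsolution k u \<and> viscosity_supersolution k u"

end

theory Submission
  imports Defs
begin

text \<open>Write rho = sqrt (2 k t0 + |x0|^2). The profile u(t, x) = g (sqrt (2 k t + |x|^2)) has
  time derivative k g'(rho) / rho at (t0, x0), and along the line x0 + tau v its second derivative
  at tau = 0 is (g'(rho) / rho) |v|^2 + (g''(rho) - g'(rho) / rho) (x0 . v / rho)^2.
  A test function touching u at (t0, x0) has the same time derivative, and its Hessian dominates
  this quadratic form if it touches from above and is dominated by it if it touches from below.
  Since g'' - g'/s >= 0, the form is at least (g'(rho) / rho) |v|^2, so all eigenvalues of the
  Hessian are at least g'(rho) / rho and the sum of the k smallest is at least k g'(rho) / rho,
  the time derivative. On the hyperplane orthogonal to x0 the form equals (g'(rho) / rho) |v|^2,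
  so at most one eigenvalue exceeds g'(rho) / rho, and k < N gives the reverse inequality.
  Both steps rely on the Hessian being symmetric (Schwarz) with N real eigenvalues counted with
  multiplicity (maximising Rayleigh quotients on invariant subspaces).\<close>

section \<open>Eigenvalues of symmetric matrices\<close>

definition symmetric_matrix :: "real^'n^'n \<Rightarrow> bool" where
  "symmetric_matrix B \<longleftrightarrow> (\<forall>x y. (B *v x) \<bullet> y = x \<bullet> (B *v y))"

definition eigenvalues :: "real^'n^'n \<Rightarrow> real set" where
  "eigenvalues B = {l. \<exists>v. v \<noteq> 0 \<and> B *v v = l *\<^sub>R v}"

lemma eigvals_mset_eq: "eigvals_mset B = (\<Sum>l\<in>eigenvalues B. replicate_mset (dim (eigenspace B l)) l)"
  unfolding eigvals_mset_def eigenvalues_def ..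

lemma subspace_eigenspace: "subspace (eigenspace B l)"
  unfolding subspace_def eigenspace_def
  by (auto simp: matrix_vector_right_distrib matrix_vector_mult_scaleR scaleR_add_right)

lemma eigenvectors_orthogonal:
  assumes "symmetric_matrix B" "B *v x = l *\<^sub>R x" "B *v y = l' *\<^sub>R y" "l \<noteq> l'"
  shows "x \<bullet> y = 0"
proof -
  have "(B *v x) \<bullet> y = x \<bullet> (B *v y)" using assms(1) by (simp add: symmetric_matrix_def)
  then have "l * (x \<bullet> y) = l' * (x \<bullet> y)" using assms(2,3) by simp
  then show ?thesis using assms(4) by simp
qed

lemma finite_eigenvalues:
  assumes "symmetric_matrix B"
  shows "finite (eigenvalues B)"
proof -
  define ev where "ev l = (SOME v. v \<noteq> 0 \<and> B *v v = l *\<^sub>R v)" for l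
  have ev: "ev l \<noteq> 0 \<and> B *v ev l = l *\<^sub>R ev l" if "l \<in> eigenvalues B" for l
    using that someI_ex[of "\<lambda>v. v \<noteq> 0 \<and> B *v v = l *\<^sub>R v"]
    unfolding eigenvalues_def ev_def by blast
  have "inj_on ev (eigenvalues B)"
    by (rule inj_onI) (metis ev scaleR_cancel_right)
  moreover have "pairwise orthogonal (ev ` eigenvalues B)"
    unfolding pairwise_def orthogonal_def using ev eigenvectors_orthogonal[OF assms] by fastforce
  then have "independent (ev ` eigenvalues B)"
    using ev by (intro pairwise_orthogonal_independent) auto
  then have "finite (ev ` eigenvalues B)"
    using independent_bound by blast
  ultimately show ?thesis
    using finite_image_iff by blast
qed

lemma set_eigvals_mset: "set_mset (eigvals_mset B) \<subseteq> eigenvalues B"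
proof (cases "finite (eigenvalues B)")
  case True
  then show ?thesis
    by (auto simp: eigvals_mset_eq set_mset_sum)
qed (simp add: eigvals_mset_eq)

lemma eq_0_if_quadratic_le_0:
  fixes a c :: real
  assumes "\<And>e. 2 * e * a + e\<^sup>2 * c \<le> 0"
  shows "a = 0"
proof -
  have "((\<lambda>e. 2 * e * a + e\<^sup>2 * c) has_real_derivative 2 * a) (at 0)"
    by (auto intro!: derivative_eq_intros)
  then have "2 * a = 0"
    by (rule DERIV_local_max[of _ _ _ 1]) (use assms in auto)
  then show ?thesis by simp
qed

lemma rayleigh_maximizer_is_eigenvector:
  assumes B: "symmetric_matrix B" and S: "subspace S" "\<And>x. x \<in> S \<Longrightarrow> B *v x \<in> S"
    and v: "v \<in> S" "v \<bullet> v = 1"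
    and max: "\<And>y. y \<in> S \<Longrightarrow> y \<bullet> (B *v y) \<le> (v \<bullet> (B *v v)) * (y \<bullet> y)"
  shows "B *v v = (v \<bullet> (B *v v)) *\<^sub>R v"
proof -
  define M where "M = v \<bullet> (B *v v)"
  define u where "u = B *v v - M *\<^sub>R v"
  have "u \<in> S"
    unfolding u_def using S v by (simp add: subspace_diff subspace_scale)
  have "u \<bullet> v = 0"
    unfolding u_def M_def using v by (simp add: inner_diff_left inner_commute[of "B *v v" v])
  then have uBv: "u \<bullet> (B *v v) = u \<bullet> u"
    by (simp add: u_def inner_diff_right)
  have "2 * e * (u \<bullet> u) + e\<^sup>2 * (u \<bullet> (B *v u) - M * (u \<bullet> u)) \<le> 0" for e
  proof -
    have "v \<bullet> (B *v u) = u \<bullet> (B *v v)"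
      using B by (simp add: symmetric_matrix_def inner_commute)
    then have "(v + e *\<^sub>R u) \<bullet> (B *v (v + e *\<^sub>R u)) = M + 2 * e * (u \<bullet> u) + e\<^sup>2 * (u \<bullet> (B *v u))"
      by (simp add: uBv M_def power2_eq_square algebra_simps)
    moreover have "(v + e *\<^sub>R u) \<bullet> (v + e *\<^sub>R u) = 1 + e\<^sup>2 * (u \<bullet> u)"
      using v \<open>u \<bullet> v = 0\<close>
      by (simp add: inner_commute[of v u] algebra_simps power2_eq_square)
    moreover have "v + e *\<^sub>R u \<in> S"
      using v \<open>u \<in> S\<close> S by (simp add: subspace_add subspace_scale)
    ultimately show ?thesis
      using max[of "v + e *\<^sub>R u"] by (simp add: M_def algebra_simps)
  qed
  then have "u \<bullet> u = 0"
    by (rule eq_0_if_quadratic_le_0)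
  then show ?thesis
    by (simp add: u_def M_def)
qed

lemma symmetric_matrix_eigenvector_in_invariant_subspace:
  fixes B :: "real^'n^'n"
  assumes B: "symmetric_matrix B" and S: "subspace S" "S \<noteq> {0}" "\<And>x. x \<in> S \<Longrightarrow> B *v x \<in> S"
  obtains v l where "v \<in> S" "v \<noteq> 0" "B *v v = l *\<^sub>R v"
proof -
  define K where "K = S \<inter> sphere 0 1"
  have "compact K"
    unfolding K_def using closed_subspace[OF S(1)] by (metis Int_commute compact_Int_closed compact_sphere)
  moreover obtain x where "x \<in> S" "x \<noteq> 0"
    using S(1,2) subspace_0 by blast
  then have "(1 / norm x) *\<^sub>R x \<in> K"
    unfolding K_def using S(1) by (simp add: subspace_scale)
  moreover have "continuous_on K (\<lambda>x. x \<bullet> (B *v x))"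
    by (intro continuous_intros)
  ultimately obtain v where v: "v \<in> K" and vmax: "\<And>y. y \<in> K \<Longrightarrow> y \<bullet> (B *v y) \<le> v \<bullet> (B *v v)"
    using continuous_attains_sup[of K "\<lambda>x. x \<bullet> (B *v x)"] by blast
  have "y \<bullet> (B *v y) \<le> (v \<bullet> (B *v v)) * (y \<bullet> y)" if "y \<in> S" for y
  proof (cases "y = 0")
    case False
    have "(1 / norm y) *\<^sub>R y \<in> K"
      unfolding K_def using False that S(1) by (simp add: subspace_scale)
    from vmax[OF this] have "(y \<bullet> (B *v y)) / (norm y)\<^sup>2 \<le> v \<bullet> (B *v v)"
      by (simp add: matrix_vector_mult_scaleR power2_eq_square)
    then show ?thesis
      using False by (simp add: divide_le_eq power2_norm_eq_inner mult.commute)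
  qed simp
  then have "B *v v = (v \<bullet> (B *v v)) *\<^sub>R v"
    using v unfolding K_def by (intro rayleigh_maximizer_is_eigenvector[OF B S(1,3)]) (auto simp: norm_eq_1)
  moreover have "v \<in> S" "v \<noteq> 0"
    using v by (auto simp: K_def)
  ultimately show ?thesis using that by blast
qed

lemma span_eigenspaces:
  fixes B :: "real^'n^'n"
  assumes B: "symmetric_matrix B"
  shows "span (\<Union>l\<in>eigenvalues B. eigenspace B l) = UNIV"
proof (rule ccontr)
  define X where "X = (\<Union>l\<in>eigenvalues B. eigenspace B l)"
  define S where "S = {y. \<forall>z\<in>span X. orthogonal z y}"
  assume "span (\<Union>l\<in>eigenvalues B. eigenspace B l) \<noteq> UNIV"
  then have "dim X \<noteq> DIM(real^'n)"
    unfolding X_def dim_eq_full .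
  then have "dim X < DIM(real^'n)"
    using dim_subset_UNIV[of X] by linarith
  then obtain x where "x \<noteq> 0" "\<And>y. y \<in> span X \<Longrightarrow> orthogonal x y"
    using orthogonal_to_subspace_exists by blast
  then have "x \<in> S" "x \<noteq> 0"
    by (auto simp: S_def orthogonal_commute)
  have "B *v z \<in> X" if "z \<in> X" for z
    using that subspace_eigenspace unfolding X_def
    by (auto simp: eigenspace_def subspace_scale matrix_vector_mult_scaleR)
  then have "span ((*v) B ` X) \<subseteq> span X"
    by (intro span_mono) auto
  then have "(*v) B ` span X \<subseteq> span X"
    by (simp add: span_linear_image)
  then have "B *v y \<in> S" if "y \<in> S" for y
  proof -
    have "z \<bullet> (B *v y) = 0" if "z \<in> span X" for z
    proof -
      have "(B *v z) \<bullet> y = 0"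
        using \<open>z \<in> span X\<close> \<open>y \<in> S\<close> \<open>(*v) B ` span X \<subseteq> span X\<close> by (auto simp: S_def orthogonal_def)
      then show ?thesis
        using B by (simp add: symmetric_matrix_def)
    qed
    then show ?thesis
      by (simp add: S_def orthogonal_def)
  qed
  moreover have "subspace S"
    unfolding S_def by (rule subspace_orthogonal_to_vectors)
  ultimately obtain v l where v: "v \<in> S" "v \<noteq> 0" "B *v v = l *\<^sub>R v"
    using symmetric_matrix_eigenvector_in_invariant_subspace[OF B] \<open>x \<in> S\<close> \<open>x \<noteq> 0\<close> by blast
  then have "v \<in> span X"
    by (intro span_base) (auto simp: X_def eigenspace_def eigenvalues_def)
  then show False
    using v(1,2) by (auto simp: S_def orthogonal_def)
qed

lemma dim_UN_le:
  fixes A :: "'i \<Rightarrow> 'a::euclidean_space set"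
  assumes "finite I"
  shows "dim (\<Union>i\<in>I. A i) \<le> (\<Sum>i\<in>I. dim (A i))"
proof -
  have "\<exists>C. C \<subseteq> A i \<and> independent C \<and> A i \<subseteq> span C \<and> card C = dim (A i)" for i
    by (meson basis_exists)
  then obtain C where C: "\<And>i. C i \<subseteq> A i \<and> independent (C i) \<and> A i \<subseteq> span (C i) \<and> card (C i) = dim (A i)"
    by metis
  have "(\<Union>i\<in>I. A i) \<subseteq> span (\<Union>i\<in>I. C i)"
  proof (rule UN_least)
    fix i assume "i \<in> I"
    then have "span (C i) \<subseteq> span (\<Union>i\<in>I. C i)"
      by (intro span_mono) auto
    then show "A i \<subseteq> span (\<Union>i\<in>I. C i)"
      using C by blast
  qed
  moreover have "finite (\<Union>i\<in>I. C i)"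
    using assms C independent_bound by blast
  ultimately have "dim (\<Union>i\<in>I. A i) \<le> card (\<Union>i\<in>I. C i)"
    by (rule dim_le_card)
  also have "\<dots> \<le> (\<Sum>i\<in>I. card (C i))"
    using assms by (rule card_UN_le)
  finally show ?thesis
    using C by simp
qed

lemma size_eigvals_mset_ge:
  fixes B :: "real^'n^'n"
  assumes "symmetric_matrix B"
  shows "CARD('n) \<le> size (eigvals_mset B)"
proof -
  have "DIM(real^'n) = dim (\<Union>l\<in>eigenvalues B. eigenspace B l)"
    using span_eigenspaces[OF assms] by (metis dim_UNIV dim_span)
  also have "\<dots> \<le> (\<Sum>l\<in>eigenvalues B. dim (eigenspace B l))"
    using finite_eigenvalues[OF assms] by (rule dim_UN_le)
  finally show ?thesis
    by (simp add: eigvals_mset_eq)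
qed

lemma length_eigvals_sorted: "length (eigvals_sorted B) = size (eigvals_mset B)"
  unfolding eigvals_sorted_def by (metis mset_sorted_list_of_multiset size_mset)

lemma set_eigvals_sorted: "set (eigvals_sorted B) \<subseteq> eigenvalues B"
  using set_eigvals_mset by (simp add: eigvals_sorted_def)

lemma Pk_minus_eq_sum_nth:
  assumes "k \<le> length (eigvals_sorted B)"
  shows "Pk_minus k B = (\<Sum>i<k. eigvals_sorted B ! i)"
  using assms by (simp add: Pk_minus_def sum_list_sum_nth atLeast0LessThan min_absorb1)

lemma Pk_minus_ge:
  fixes B :: "real^'n^'n"
  assumes B: "symmetric_matrix B" and k: "k \<le> CARD('n)"
    and form_ge: "\<And>v. p * (v \<bullet> v) \<le> v \<bullet> (B *v v)"
  shows "real k * p \<le> Pk_minus k B"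
proof -
  have len: "k \<le> length (eigvals_sorted B)"
    using size_eigvals_mset_ge[OF B] k by (simp add: length_eigvals_sorted)
  have "p \<le> eigvals_sorted B ! i" if "i < k" for i
  proof -
    have "eigvals_sorted B ! i \<in> eigenvalues B"
      using set_eigvals_sorted len that by (meson nth_mem order_less_le_trans subsetD)
    then obtain v where "v \<noteq> 0" "B *v v = (eigvals_sorted B ! i) *\<^sub>R v"
      by (auto simp: eigenvalues_def)
    then show ?thesis
      using form_ge[of v] by simp
  qed
  then show ?thesis
    using sum_bounded_below[of "{..<k}" p] len by (simp add: Pk_minus_eq_sum_nth)
qed

lemma hyperplane_bound_excludes_orthogonal_eigenvectors:
  fixes B :: "real^'n^'n"
  assumes bound: "\<And>v. v \<bullet> w = 0 \<Longrightarrow> v \<bullet> (B *v v) \<le> p * (v \<bullet> v)"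
    and e: "e \<noteq> 0" "B *v e = l *\<^sub>R e" "p < l"
    and e': "e' \<noteq> 0" "B *v e' = l' *\<^sub>R e'" "p < l'"
    and orth: "e \<bullet> e' = 0"
  shows False
proof -
  define a where "a = e' \<bullet> w"
  define b where "b = e \<bullet> w"
  \<comment> \<open>x lies in the hyperplane, and the bound forces b = 0, i.e. e lies in it too.\<close>
  define x where "x = a *\<^sub>R e - b *\<^sub>R e'"
  have "x \<bullet> w = 0"
    unfolding x_def a_def b_def by (simp add: inner_diff_left)
  then have "x \<bullet> (B *v x) \<le> p * (x \<bullet> x)"
    by (rule bound)
  moreover have "B *v x = (a * l) *\<^sub>R e - (b * l') *\<^sub>R e'"
    unfolding x_def using e e' by (simp add: matrix_vector_mult_diff_distrib matrix_vector_mult_scaleR)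
  then have "x \<bullet> (B *v x) = a\<^sup>2 * l * (e \<bullet> e) + b\<^sup>2 * l' * (e' \<bullet> e')"
    "x \<bullet> x = a\<^sup>2 * (e \<bullet> e) + b\<^sup>2 * (e' \<bullet> e')"
    unfolding x_def using orth
    by (simp_all add: inner_diff_left inner_diff_right inner_commute[of e' e] power2_eq_square)
  ultimately have "a\<^sup>2 * ((l - p) * (e \<bullet> e)) + b\<^sup>2 * ((l' - p) * (e' \<bullet> e')) \<le> 0"
    by (simp add: algebra_simps)
  moreover have "0 < (l - p) * (e \<bullet> e)" "0 < (l' - p) * (e' \<bullet> e')"
    using e e' by simp_all
  ultimately have "b\<^sup>2 * ((l' - p) * (e' \<bullet> e')) = 0"
    by (smt (verit) mult_nonneg_nonneg zero_le_power2)
  then have "b = 0"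
    using e' by simp
  then have "e \<bullet> (B *v e) \<le> p * (e \<bullet> e)"
    using bound b_def by simp
  then show False
    using e by simp
qed

lemma dim_eigenspace_above_le_1:
  fixes B :: "real^'n^'n"
  assumes bound: "\<And>v. v \<bullet> w = 0 \<Longrightarrow> v \<bullet> (B *v v) \<le> p * (v \<bullet> v)" and "p < l"
  shows "dim (eigenspace B l) \<le> 1"
proof (rule ccontr)
  assume "\<not> dim (eigenspace B l) \<le> 1"
  moreover obtain E where E: "E \<subseteq> eigenspace B l" "pairwise orthogonal E" "\<And>x. x \<in> E \<Longrightarrow> norm x = 1"
    "card E = dim (eigenspace B l)"
    using orthonormal_basis_subspace[OF subspace_eigenspace] by metis
  ultimately have "finite E" "\<not> card E \<le> Suc 0"
    by (auto intro: card_ge_0_finite)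
  then obtain e e' where "e \<in> E" "e' \<in> E" "e \<noteq> e'"
    using card_le_Suc0_iff_eq by blast
  moreover have "0 \<notin> E"
    using E(3) by force
  ultimately have "e \<noteq> 0" "B *v e = l *\<^sub>R e" "e' \<noteq> 0" "B *v e' = l *\<^sub>R e'" "e \<bullet> e' = 0"
    using E(1,2) by (auto simp: eigenspace_def pairwise_def orthogonal_def)
  then show False
    using hyperplane_bound_excludes_orthogonal_eigenvectors[OF bound] \<open>p < l\<close> by blast
qed

lemma card_eigenvalues_above_le_1:
  fixes B :: "real^'n^'n"
  assumes B: "symmetric_matrix B"
    and bound: "\<And>v. v \<bullet> w = 0 \<Longrightarrow> v \<bullet> (B *v v) \<le> p * (v \<bullet> v)"
  shows "card {l \<in> eigenvalues B. p < l} \<le> 1"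
proof (rule ccontr)
  assume "\<not> card {l \<in> eigenvalues B. p < l} \<le> 1"
  then obtain l l' where "l \<in> eigenvalues B" "l' \<in> eigenvalues B" "p < l" "p < l'" "l \<noteq> l'"
    using card_le_Suc0_iff_eq[of "{l \<in> eigenvalues B. p < l}"] finite_eigenvalues[OF B] by auto
  moreover from this obtain e e' where "e \<noteq> 0" "B *v e = l *\<^sub>R e" "e' \<noteq> 0" "B *v e' = l' *\<^sub>R e'"
    by (auto simp: eigenvalues_def)
  ultimately show False
    using hyperplane_bound_excludes_orthogonal_eigenvectors[OF bound] eigenvectors_orthogonal[OF B]
    by metis
qed

lemma filter_mset_sum: "filter_mset P (\<Sum>a\<in>A. f a) = (\<Sum>a\<in>A. filter_mset P (f a))"
  by (induction A rule: infinite_finite_induct) auto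

lemma size_filter_replicate_mset: "size (filter_mset P (replicate_mset n x)) = (if P x then n else 0)"
  by (induction n) auto

lemma size_filter_eigvals_mset_above_le_1:
  fixes B :: "real^'n^'n"
  assumes B: "symmetric_matrix B"
    and bound: "\<And>v. v \<bullet> w = 0 \<Longrightarrow> v \<bullet> (B *v v) \<le> p * (v \<bullet> v)"
  shows "size (filter_mset (\<lambda>l. p < l) (eigvals_mset B)) \<le> 1"
proof -
  have "size (filter_mset (\<lambda>l. p < l) (eigvals_mset B)) = (\<Sum>l\<in>{l \<in> eigenvalues B. p < l}. dim (eigenspace B l))"
    using finite_eigenvalues[OF B]
    by (simp add: eigvals_mset_eq filter_mset_sum size_filter_replicate_mset sum.inter_filter)
  also have "\<dots> \<le> card {l \<in> eigenvalues B. p < l}"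
  proof -
    have "dim (eigenspace B l) \<le> 1" if "l \<in> {l \<in> eigenvalues B. p < l}" for l
      using bound that by (intro dim_eigenspace_above_le_1) auto
    then show ?thesis
      using sum_bounded_above[of "{l \<in> eigenvalues B. p < l}" "\<lambda>l. dim (eigenspace B l)" 1] by simp
  qed
  also have "\<dots> \<le> 1"
    using card_eigenvalues_above_le_1[OF B bound] by simp
  finally show ?thesis .
qed

lemma sorted_nth_le_if_at_most_one_greater:
  fixes xs :: "'a::linorder list"
  assumes "sorted xs" "length (filter (\<lambda>x. p < x) xs) \<le> 1" "Suc i < length xs"
  shows "xs ! i \<le> p"
proof (rule ccontr)
  assume "\<not> xs ! i \<le> p"
  moreover have "xs ! i \<le> xs ! Suc i"
    using assms(1,3) by (simp add: sorted_iff_nth_mono)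
  ultimately have "{i, Suc i} \<subseteq> {j. j < length xs \<and> p < xs ! j}"
    using assms(3) by auto
  then have "2 \<le> length (filter (\<lambda>x. p < x) xs)"
    unfolding length_filter_conv_card by (metis card_2_iff card_mono finite_Collect_conjI finite_Collect_less_nat n_not_Suc_n)
  then show False
    using assms(2) by simp
qed

lemma Pk_minus_le:
  fixes B :: "real^'n^'n"
  assumes B: "symmetric_matrix B" and k: "k < CARD('n)"
    and bound: "\<And>v. v \<bullet> w = 0 \<Longrightarrow> v \<bullet> (B *v v) \<le> p * (v \<bullet> v)"
  shows "Pk_minus k B \<le> real k * p"
proof -
  have len: "k < length (eigvals_sorted B)"
    using size_eigvals_mset_ge[OF B] k by (simp add: length_eigvals_sorted)
  have "length (filter (\<lambda>l. p < l) (eigvals_sorted B)) \<le> 1"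
    using size_filter_eigvals_mset_above_le_1[OF B bound]
    by (metis eigvals_sorted_def mset_filter mset_sorted_list_of_multiset size_mset)
  then have "eigvals_sorted B ! i \<le> p" if "i < k" for i
    using len that by (intro sorted_nth_le_if_at_most_one_greater) (auto simp: eigvals_sorted_def)
  then show ?thesis
    using sum_bounded_above[of "{..<k}" _ p] len by (simp add: Pk_minus_eq_sum_nth)
qed


section \<open>Symmetry of second derivatives\<close>

lemma has_real_derivative_along_line:
  fixes F :: "'a::real_normed_vector \<Rightarrow> real"
  assumes "(F has_derivative F') (at (a + t *\<^sub>R v))"
  shows "((\<lambda>t. F (a + t *\<^sub>R v)) has_real_derivative F' v) (at t)"
proof -
  have "((\<lambda>t. a + t *\<^sub>R v) has_derivative (\<lambda>d. d *\<^sub>R v)) (at t)"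
    by (auto intro!: derivative_eq_intros)
  from has_derivative_compose[OF this assms]
  have "((\<lambda>t. F (a + t *\<^sub>R v)) has_derivative (\<lambda>d. F' (d *\<^sub>R v))) (at t)"
    by (simp add: o_def)
  moreover have "(\<lambda>d. F' (d *\<^sub>R v)) = (*) (F' v)"
    using linear_cmul[OF has_derivative_linear[OF assms]] by (auto simp: mult.commute)
  ultimately show ?thesis
    by (simp add: has_field_derivative_def)
qed

lemma bounded_linear_matrix_vector_mult_left: "bounded_linear (\<lambda>A::real^'n^'m. A *v x)"
  by (simp add: linear_conv_bounded_linear[symmetric] linearI matrix_vector_mult_add_rdistrib
      scaleR_matrix_vector_assoc)

lemma second_difference_mean_value:
  fixes f :: "real^'n \<Rightarrow> real" and G :: "real^'n \<Rightarrow> real^'n" and H :: "real^'n \<Rightarrow> real^'n^'n"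
  assumes f: "\<And>y. (f has_derivative (\<lambda>d. G y \<bullet> d)) (at y)"
    and G: "\<And>y. (G has_derivative (\<lambda>d. H y *v d)) (at y)"
    and s: "s > 0"
  obtains y where "dist y x \<le> s * (norm h + norm k)"
    "f (x + s *\<^sub>R k + s *\<^sub>R h) - f (x + s *\<^sub>R h) - f (x + s *\<^sub>R k) + f x = s * (s * ((H y *v k) \<bullet> h))"
proof -
  define \<phi> where "\<phi> \<tau> = f ((x + s *\<^sub>R k) + \<tau> *\<^sub>R h) - f (x + \<tau> *\<^sub>R h)" for \<tau>
  define \<psi> where "\<psi> \<tau> = G ((x + s *\<^sub>R k) + \<tau> *\<^sub>R h) \<bullet> h - G (x + \<tau> *\<^sub>R h) \<bullet> h" for \<tau>
  have "(\<phi> has_real_derivative \<psi> \<tau>) (at \<tau>)" for \<tau>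
    unfolding \<phi>_def \<psi>_def by (intro DERIV_diff has_real_derivative_along_line f)
  then obtain \<xi> where \<xi>: "0 < \<xi>" "\<xi> < s" "\<phi> s - \<phi> 0 = s * \<psi> \<xi>"
    using MVT2[OF s, of \<phi> \<psi>] by auto
  define z where "z = x + \<xi> *\<^sub>R h"
  have "((\<lambda>y. G y \<bullet> h) has_derivative (\<lambda>d. (H y *v d) \<bullet> h)) (at y)" for y
    using bounded_linear.has_derivative[OF bounded_linear_inner_left G] .
  then have "((\<lambda>\<sigma>. G (z + \<sigma> *\<^sub>R k) \<bullet> h) has_real_derivative (H (z + \<sigma> *\<^sub>R k) *v k) \<bullet> h) (at \<sigma>)" for \<sigma>
    by (rule has_real_derivative_along_line)
  then obtain \<eta> where \<eta>: "0 < \<eta>" "\<eta> < s"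
    "G (z + s *\<^sub>R k) \<bullet> h - G z \<bullet> h = s * ((H (z + \<eta> *\<^sub>R k) *v k) \<bullet> h)"
    using MVT2[OF s, of "\<lambda>\<sigma>. G (z + \<sigma> *\<^sub>R k) \<bullet> h" "\<lambda>\<sigma>. (H (z + \<sigma> *\<^sub>R k) *v k) \<bullet> h"] by auto
  define y where "y = z + \<eta> *\<^sub>R k"
  have "dist y x = norm (\<xi> *\<^sub>R h + \<eta> *\<^sub>R k)"
    by (simp add: y_def z_def dist_norm)
  also have "\<dots> \<le> \<xi> * norm h + \<eta> * norm k"
    using \<xi> \<eta> norm_triangle_ineq[of "\<xi> *\<^sub>R h" "\<eta> *\<^sub>R k"] by simp
  also have "\<dots> \<le> s * (norm h + norm k)"
    using \<xi> \<eta> by (simp add: distrib_left add_mono mult_right_mono)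
  moreover have "\<psi> \<xi> = G (z + s *\<^sub>R k) \<bullet> h - G z \<bullet> h"
    by (simp add: \<psi>_def z_def algebra_simps)
  ultimately show ?thesis
    using that[of y] \<xi>(3) \<eta>(3) unfolding \<phi>_def y_def by simp
qed

lemma hessian_symmetric:
  fixes f :: "real^'n \<Rightarrow> real" and G :: "real^'n \<Rightarrow> real^'n" and H :: "real^'n \<Rightarrow> real^'n^'n"
  assumes f: "\<And>y. (f has_derivative (\<lambda>d. G y \<bullet> d)) (at y)"
    and G: "\<And>y. (G has_derivative (\<lambda>d. H y *v d)) (at y)"
    and H: "isCont H x"
  shows "(H x *v k) \<bullet> h = (H x *v h) \<bullet> k"
proof -
  define F1 where "F1 y = (H y *v k) \<bullet> h" for y
  define F2 where "F2 y = (H y *v h) \<bullet> k" for y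
  have "isCont F1 x" "isCont F2 x"
    unfolding F1_def F2_def
    by (intro continuous_intros bounded_linear.isCont[OF bounded_linear_matrix_vector_mult_left H])+
  have "\<bar>F1 x - F2 x\<bar> < 2 * e" if "e > 0" for e
  proof -
    obtain d where d: "d > 0" "\<And>y. dist y x < d \<Longrightarrow> dist (F1 y) (F1 x) < e \<and> dist (F2 y) (F2 x) < e"
      using \<open>isCont F1 x\<close> \<open>isCont F2 x\<close> \<open>e > 0\<close> unfolding continuous_at_eps_delta
      by (metis min_less_iff_conj)
    have c: "norm h + norm k + 1 > 0"
      using norm_ge_zero[of h] norm_ge_zero[of k] by linarith
    define s where "s = d / (2 * (norm h + norm k + 1))"
    have "s > 0"
      using d c by (simp add: s_def)
    have close: "dist y x < d" if "dist y x \<le> s * (norm h + norm k)" for y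
    proof -
      have "s * (norm h + norm k) < s * (2 * (norm h + norm k + 1))"
        using \<open>s > 0\<close> c by (intro mult_strict_left_mono) auto
      also have "\<dots> = d"
        using c by (simp add: s_def)
      finally show ?thesis
        using that by linarith
    qed
    obtain y1 where y1: "dist y1 x \<le> s * (norm h + norm k)"
      "f (x + s *\<^sub>R k + s *\<^sub>R h) - f (x + s *\<^sub>R h) - f (x + s *\<^sub>R k) + f x = s * (s * F1 y1)"
      using second_difference_mean_value[OF f G \<open>s > 0\<close>] unfolding F1_def by blast
    obtain y2 where y2: "dist y2 x \<le> s * (norm k + norm h)"
      "f (x + s *\<^sub>R h + s *\<^sub>R k) - f (x + s *\<^sub>R k) - f (x + s *\<^sub>R h) + f x = s * (s * F2 y2)"
      using second_difference_mean_value[OF f G \<open>s > 0\<close>] unfolding F2_def by blast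
    have "F1 y1 = F2 y2"
      using y1(2) y2(2) \<open>s > 0\<close> by (simp add: algebra_simps)
    moreover have "dist (F1 y1) (F1 x) < e" "dist (F2 y2) (F2 x) < e"
      using d close y1(1) y2(1) by (auto simp: add.commute)
    ultimately show ?thesis
      by (simp add: dist_real_def)
  qed
  from this[of "\<bar>F1 x - F2 x\<bar> / 2"] have "F1 x = F2 x"
    by (cases "F1 x = F2 x") auto
  then show ?thesis
    by (simp add: F1_def F2_def)
qed

lemma DERIV_local_max_second_order:
  fixes h h' :: "real \<Rightarrow> real"
  assumes h: "\<And>\<tau>. (h has_real_derivative h' \<tau>) (at \<tau>)" and h': "(h' has_real_derivative L) (at 0)"
    and d: "d > 0" and max: "\<And>\<tau>. \<bar>\<tau>\<bar> < d \<Longrightarrow> h \<tau> \<le> h 0"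
  shows "L \<le> 0"
proof (rule ccontr)
  assume "\<not> L \<le> 0"
  then obtain d' where d': "d' > 0" "\<And>\<delta>. \<delta> > 0 \<Longrightarrow> \<delta> < d' \<Longrightarrow> h' 0 < h' \<delta>"
    using DERIV_pos_inc_right[OF h'] by force
  have "h' 0 = 0"
    using DERIV_local_max[OF h d] max by simp
  define \<tau> where "\<tau> = min d d' / 2"
  have \<tau>: "0 < \<tau>" "\<tau> < d" "\<tau> < d'"
    using d d' by (auto simp: \<tau>_def)
  then obtain z where z: "0 < z" "z < \<tau>" "h \<tau> - h 0 = \<tau> * h' z"
    using MVT2[OF \<tau>(1), of h h'] h by auto
  moreover have "h' z > 0"
    using d'(2)[of z] z \<tau> \<open>h' 0 = 0\<close> by simp
  ultimately have "h \<tau> > h 0"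
    using z(3) \<tau>(1) by (metis diff_gt_0_iff_gt mult_pos_pos)
  with max[of \<tau>] \<tau> show False
    by simp
qed


section \<open>Touching the radial profile by test functions\<close>

lemma isCont_slice_pdom:
  fixes F :: "real \<Rightarrow> real^'n \<Rightarrow> 'b::topological_space"
  assumes "continuous_on pdom (\<lambda>(t, x). F t x)" "t > 0"
  shows "isCont (F t) x"
proof -
  have "continuous_on UNIV (\<lambda>y. (\<lambda>(t, x). F t x) (t, y))"
    using assms(2)
    by (intro continuous_on_compose2[OF assms(1)] continuous_on_Pair continuous_on_const continuous_on_id)
      (auto simp: pdom_def)
  then show ?thesis
    by (simp add: continuous_on_eq_continuous_at)
qed

lemma C12_test_hessian_symmetric:
  assumes C: "C12_test phi phit Dphi D2phi" and "t > 0"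
  shows "symmetric_matrix (D2phi t x)"
proof -
  have "(D2phi t x *v k) \<bullet> h = (D2phi t x *v h) \<bullet> k" for h k
    using C \<open>t > 0\<close> unfolding C12_test_def
    by (intro hessian_symmetric[of "phi t" "Dphi t"] isCont_slice_pdom) blast+
  then show ?thesis
    by (simp add: symmetric_matrix_def inner_commute)
qed

lemma C12_test_derivatives:
  assumes C: "C12_test phi phit Dphi D2phi" and "t > 0"
  shows "((\<lambda>s. phi s x) has_real_derivative phit t x) (at t)"
    and "((\<lambda>\<tau>. phi t (x + \<tau> *\<^sub>R v)) has_real_derivative Dphi t (x + \<tau> *\<^sub>R v) \<bullet> v) (at \<tau>)"
    and "((\<lambda>\<tau>. Dphi t (x + \<tau> *\<^sub>R v) \<bullet> v) has_real_derivative v \<bullet> (D2phi t x *v v)) (at 0)"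
proof -
  show "((\<lambda>s. phi s x) has_real_derivative phit t x) (at t)"
    using C \<open>t > 0\<close> unfolding C12_test_def by blast
  have phi: "((\<lambda>y. phi t y) has_derivative (\<lambda>h. Dphi t y \<bullet> h)) (at y)"
    and Dphi: "((\<lambda>y. Dphi t y) has_derivative (\<lambda>h. D2phi t y *v h)) (at y)" for y
    using C \<open>t > 0\<close> unfolding C12_test_def by blast+
  show "((\<lambda>\<tau>. phi t (x + \<tau> *\<^sub>R v)) has_real_derivative Dphi t (x + \<tau> *\<^sub>R v) \<bullet> v) (at \<tau>)"
    using phi by (rule has_real_derivative_along_line)
  have "((\<lambda>y. Dphi t y \<bullet> v) has_derivative (\<lambda>h. (D2phi t x *v h) \<bullet> v)) (at (x + 0 *\<^sub>R v))"
    using bounded_linear.has_derivative[OF bounded_linear_inner_left Dphi] by simp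
  from has_real_derivative_along_line[OF this]
  show "((\<lambda>\<tau>. Dphi t (x + \<tau> *\<^sub>R v) \<bullet> v) has_real_derivative v \<bullet> (D2phi t x *v v)) (at 0)"
    by (simp add: inner_commute)
qed

lemma local_max_at_derivative_tests:
  fixes w :: "real \<Rightarrow> real^'n \<Rightarrow> real"
  assumes max: "local_max_at w t0 x0" and "t0 > 0"
    and wt: "((\<lambda>s. w s x0) has_real_derivative wt) (at t0)"
    and w': "\<And>\<tau>. ((\<lambda>\<tau>. w t0 (x0 + \<tau> *\<^sub>R v)) has_real_derivative w' \<tau>) (at \<tau>)"
    and w'': "(w' has_real_derivative w'') (at 0)"
  shows "wt = 0" and "w'' \<le> 0"
proof -
  obtain e where "e > 0" and e: "\<And>s y. s > 0 \<Longrightarrow> \<bar>s - t0\<bar> < e \<Longrightarrow> dist y x0 < e \<Longrightarrow> w s y \<le> w t0 x0"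
    using max unfolding local_max_at_def by blast
  have "w s x0 \<le> w t0 x0" if "\<bar>t0 - s\<bar> < min e t0" for s
    using e[of s x0] that \<open>e > 0\<close> by (auto simp: abs_minus_commute abs_less_iff)
  then show "wt = 0"
    using \<open>e > 0\<close> \<open>t0 > 0\<close> by (intro DERIV_local_max[OF wt, of "min e t0"]) auto
  have "w t0 (x0 + \<tau> *\<^sub>R v) \<le> w t0 (x0 + 0 *\<^sub>R v)" if "\<bar>\<tau>\<bar> < e / (norm v + 1)" for \<tau>
  proof -
    have "\<bar>\<tau>\<bar> * norm v \<le> \<bar>\<tau>\<bar> * (norm v + 1)"
      by (simp add: mult_left_mono)
    also have "\<dots> < e"
      using that by (simp add: pos_less_divide_eq add_nonneg_pos)
    finally show ?thesis
      using e[OF \<open>t0 > 0\<close>] \<open>e > 0\<close> by (simp add: dist_norm)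
  qed
  moreover have "0 < e / (norm v + 1)"
    using \<open>e > 0\<close> by (simp add: add_nonneg_pos)
  ultimately show "w'' \<le> 0"
    using DERIV_local_max_second_order[OF w' w''] by blast
qed

lemma local_min_at_iff_local_max_at_uminus: "local_min_at w t0 x0 \<longleftrightarrow> local_max_at (\<lambda>s y. - w s y) t0 x0"
  by (simp add: local_min_at_def local_max_at_def)

definition radial_profile :: "nat \<Rightarrow> (real \<Rightarrow> real) \<Rightarrow> real \<Rightarrow> 'a::real_normed_vector \<Rightarrow> real" where
  "radial_profile k g t x = g (sqrt (2 * real k * t + (norm x)\<^sup>2))"

lemma continuous_on_radial_profile:
  assumes g: "\<And>s. s > 0 \<Longrightarrow> isCont g s" and "0 < k"
  shows "continuous_on pdom (\<lambda>(t, x). radial_profile k g t x)"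
proof -
  have "continuous_on pdom (\<lambda>z::real \<times> (real^'n). g (sqrt (2 * real k * fst z + (norm (snd z))\<^sup>2)))"
  proof (rule continuous_on_compose2[of "{0<..}" g])
    show "continuous_on {0<..} g"
      using g by (simp add: continuous_at_imp_continuous_on)
    show "(\<lambda>z::real \<times> (real^'n). sqrt (2 * real k * fst z + (norm (snd z))\<^sup>2)) ` pdom \<subseteq> {0<..}"
      using \<open>0 < k\<close> by (auto simp: pdom_def add_pos_nonneg)
  qed (intro continuous_intros)
  then show ?thesis
    by (simp add: radial_profile_def case_prod_unfold)
qed

lemma radial_profile_time_derivative:
  fixes k :: nat and t :: real and x :: "'a::real_normed_vector"
  defines "\<rho> \<equiv> sqrt (2 * real k * t + (norm x)\<^sup>2)"
  assumes g: "(g has_real_derivative g' \<rho>) (at \<rho>)" and "0 < k" "0 < t"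
  shows "((\<lambda>s. radial_profile k g s x) has_real_derivative real k * (g' \<rho> / \<rho>)) (at t)"
proof -
  have "0 < 2 * real k * t + (norm x)\<^sup>2"
    using assms by (simp add: add_pos_nonneg)
  then have "((\<lambda>s. sqrt (2 * real k * s + (norm x)\<^sup>2)) has_real_derivative real k / \<rho>) (at t)"
    unfolding \<rho>_def by (auto intro!: derivative_eq_intros simp: field_simps)
  from DERIV_chain2[OF g[unfolded \<rho>_def] this[unfolded \<rho>_def]] show ?thesis
    by (simp add: radial_profile_def \<rho>_def mult.commute)
qed

lemma radial_profile_line_derivatives:
  fixes k :: nat and t :: real and x v :: "'a::real_inner"
  defines "\<rho> \<equiv> sqrt (2 * real k * t + (norm x)\<^sup>2)"
  assumes g: "\<forall>s>0. (g has_real_derivative g' s) (at s) \<and> (g' has_real_derivative g'' s) (at s)"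
    and "0 < k" "0 < t"
  obtains u' where "\<And>\<tau>. ((\<lambda>\<tau>. radial_profile k g t (x + \<tau> *\<^sub>R v)) has_real_derivative u' \<tau>) (at \<tau>)"
    and "(u' has_real_derivative (g' \<rho> / \<rho>) * (v \<bullet> v) + (g'' \<rho> - g' \<rho> / \<rho>) * ((x \<bullet> v) / \<rho>)\<^sup>2) (at 0)"
proof -
  have norm_line: "(norm (x + \<tau> *\<^sub>R v))\<^sup>2 = (norm x)\<^sup>2 + 2 * \<tau> * (x \<bullet> v) + \<tau>\<^sup>2 * (v \<bullet> v)" for \<tau>
    unfolding power2_norm_eq_inner by (simp add: inner_commute[of v x] power2_eq_square algebra_simps)
  define r where "r \<tau> = sqrt (2 * real k * t + (norm x)\<^sup>2 + 2 * \<tau> * (x \<bullet> v) + \<tau>\<^sup>2 * (v \<bullet> v))" for \<tau>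
  define q where "q \<tau> = ((x \<bullet> v) + \<tau> * (v \<bullet> v)) / r \<tau>" for \<tau>
  have pos: "0 < 2 * real k * t + (norm x)\<^sup>2 + 2 * \<tau> * (x \<bullet> v) + \<tau>\<^sup>2 * (v \<bullet> v)" for \<tau>
  proof -
    have "0 < 2 * real k * t + (norm (x + \<tau> *\<^sub>R v))\<^sup>2"
      using \<open>0 < k\<close> \<open>0 < t\<close> by (simp add: add_pos_nonneg)
    then show ?thesis
      by (simp add: norm_line add.assoc)
  qed
  then have "r \<tau> > 0" for \<tau>
    by (simp add: r_def)
  have "r 0 = \<rho>"
    by (simp add: r_def \<rho>_def)
  have r: "(r has_real_derivative q \<tau>) (at \<tau>)" for \<tau>
    unfolding r_def q_def using pos[of \<tau>]
    by (auto intro!: derivative_eq_intros simp: field_simps)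
  have q: "(q has_real_derivative ((v \<bullet> v) * \<rho> - (x \<bullet> v) * q 0) / \<rho>\<^sup>2) (at 0)"
    unfolding q_def using r[of 0] \<open>r 0 = \<rho>\<close> \<open>r 0 > 0\<close>
    by (auto intro!: derivative_eq_intros simp: q_def power2_eq_square)
  have "(g' has_real_derivative g'' (r 0)) (at (r 0))"
    using g \<open>r 0 > 0\<close> by blast
  from DERIV_chain2[OF this r]
  have "((\<lambda>\<tau>. g' (r \<tau>)) has_real_derivative g'' \<rho> * q 0) (at 0)"
    by (simp add: \<open>r 0 = \<rho>\<close>)
  from DERIV_mult[OF this q]
  have "((\<lambda>\<tau>. g' (r \<tau>) * q \<tau>) has_real_derivative
      g'' \<rho> * q 0 * q 0 + g' \<rho> * (((v \<bullet> v) * \<rho> - (x \<bullet> v) * q 0) / \<rho>\<^sup>2)) (at 0)"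
    by (simp add: \<open>r 0 = \<rho>\<close> mult.commute)
  moreover have "g'' \<rho> * q 0 * q 0 + g' \<rho> * (((v \<bullet> v) * \<rho> - (x \<bullet> v) * q 0) / \<rho>\<^sup>2)
      = (g' \<rho> / \<rho>) * (v \<bullet> v) + (g'' \<rho> - g' \<rho> / \<rho>) * ((x \<bullet> v) / \<rho>)\<^sup>2"
    using \<open>r 0 = \<rho>\<close> \<open>r 0 > 0\<close> by (simp add: q_def field_simps power2_eq_square)
  moreover have "((\<lambda>\<tau>. radial_profile k g t (x + \<tau> *\<^sub>R v)) has_real_derivative g' (r \<tau>) * q \<tau>) (at \<tau>)" for \<tau>
    using DERIV_chain2[OF _ r[of \<tau>], of g "g' (r \<tau>)"] g \<open>r \<tau> > 0\<close>
    by (simp add: radial_profile_def r_def norm_line add.assoc)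
  ultimately show ?thesis
    using that[of "\<lambda>\<tau>. g' (r \<tau>) * q \<tau>"] by simp
qed

lemma radial_profile_touching:
  fixes phi :: "real \<Rightarrow> real^'n \<Rightarrow> real" and k :: nat and t0 :: real and x0 :: "real^'n"
  defines "\<rho> \<equiv> sqrt (2 * real k * t0 + (norm x0)\<^sup>2)"
  assumes g: "\<forall>s>0. (g has_real_derivative g' s) (at s) \<and> (g' has_real_derivative g'' s) (at s)"
    and "0 < k" "0 < t0" and C: "C12_test phi phit Dphi D2phi" and "\<sigma> \<noteq> 0"
    and max: "local_max_at (\<lambda>s y. \<sigma> * (radial_profile k g s y - phi s y)) t0 x0"
  shows "phit t0 x0 = real k * (g' \<rho> / \<rho>)"
    and "\<sigma> * ((g' \<rho> / \<rho>) * (v \<bullet> v) + (g'' \<rho> - g' \<rho> / \<rho>) * ((x0 \<bullet> v) / \<rho>)\<^sup>2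
           - v \<bullet> (D2phi t0 x0 *v v)) \<le> 0"
proof -
  have "\<rho> > 0"
    using \<open>0 < k\<close> \<open>0 < t0\<close> by (simp add: \<rho>_def add_pos_nonneg)
  obtain u' where u': "\<And>\<tau>. ((\<lambda>\<tau>. radial_profile k g t0 (x0 + \<tau> *\<^sub>R v)) has_real_derivative u' \<tau>) (at \<tau>)"
    and u'': "(u' has_real_derivative (g' \<rho> / \<rho>) * (v \<bullet> v) + (g'' \<rho> - g' \<rho> / \<rho>) * ((x0 \<bullet> v) / \<rho>)\<^sup>2) (at 0)"
    using radial_profile_line_derivatives[OF g \<open>0 < k\<close> \<open>0 < t0\<close>] unfolding \<rho>_def by blast
  have ut: "((\<lambda>s. radial_profile k g s x0) has_real_derivative real k * (g' \<rho> / \<rho>)) (at t0)"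
    using g \<open>\<rho> > 0\<close> \<open>0 < k\<close> \<open>0 < t0\<close> unfolding \<rho>_def by (intro radial_profile_time_derivative) blast+
  have wt: "((\<lambda>s. \<sigma> * (radial_profile k g s x0 - phi s x0)) has_real_derivative
      \<sigma> * (real k * (g' \<rho> / \<rho>) - phit t0 x0)) (at t0)"
    by (intro DERIV_cmult DERIV_diff ut C12_test_derivatives(1)[OF C \<open>0 < t0\<close>])
  have w': "((\<lambda>\<tau>. \<sigma> * (radial_profile k g t0 (x0 + \<tau> *\<^sub>R v) - phi t0 (x0 + \<tau> *\<^sub>R v)))
      has_real_derivative \<sigma> * (u' \<tau> - Dphi t0 (x0 + \<tau> *\<^sub>R v) \<bullet> v)) (at \<tau>)" for \<tau>
    by (intro DERIV_cmult DERIV_diff u' C12_test_derivatives(2)[OF C \<open>0 < t0\<close>])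
  have w'': "((\<lambda>\<tau>. \<sigma> * (u' \<tau> - Dphi t0 (x0 + \<tau> *\<^sub>R v) \<bullet> v)) has_real_derivative
      \<sigma> * ((g' \<rho> / \<rho>) * (v \<bullet> v) + (g'' \<rho> - g' \<rho> / \<rho>) * ((x0 \<bullet> v) / \<rho>)\<^sup>2
        - v \<bullet> (D2phi t0 x0 *v v))) (at 0)"
    by (intro DERIV_cmult DERIV_diff u'' C12_test_derivatives(3)[OF C \<open>0 < t0\<close>])
  note tests = local_max_at_derivative_tests[OF max \<open>0 < t0\<close> wt w' w'']
  show "phit t0 x0 = real k * (g' \<rho> / \<rho>)"
    using tests(1) \<open>\<sigma> \<noteq> 0\<close> by simp
  show "\<sigma> * ((g' \<rho> / \<rho>) * (v \<bullet> v) + (g'' \<rho> - g' \<rho> / \<rho>) * ((x0 \<bullet> v) / \<rho>)\<^sup>2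
           - v \<bullet> (D2phi t0 x0 *v v)) \<le> 0"
    by (fact tests(2))
qed

lemma radial_profile_viscosity_subsolution:
  fixes g :: "real \<Rightarrow> real"
  assumes g: "\<forall>s>0. (g has_real_derivative g' s) (at s) \<and> (g' has_real_derivative g'' s) (at s)"
    and g'': "\<forall>s>0. g' s / s \<le> g'' s"
    and "0 < k" "k \<le> CARD('n)"
  shows "viscosity_subsolution k (radial_profile k g :: real \<Rightarrow> real^'n \<Rightarrow> real)"
  unfolding viscosity_subsolution_def
proof (intro allI impI, elim conjE)
  fix t0 x0 and phi :: "real \<Rightarrow> real^'n \<Rightarrow> real" and phit Dphi D2phi
  assume "0 < t0" and C: "C12_test phi phit Dphi D2phi"
    and "local_max_at (\<lambda>s y. radial_profile k g s y - phi s y) t0 x0"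
  then have max: "local_max_at (\<lambda>s y. 1 * (radial_profile k g s y - phi s y)) t0 x0"
    by simp
  define \<rho> where "\<rho> = sqrt (2 * real k * t0 + (norm x0)\<^sup>2)"
  have "\<rho> > 0"
    using \<open>0 < k\<close> \<open>0 < t0\<close> by (simp add: \<rho>_def add_pos_nonneg)
  note touching = radial_profile_touching[OF g \<open>0 < k\<close> \<open>0 < t0\<close> C one_neq_zero max, folded \<rho>_def]
  have "(g' \<rho> / \<rho>) * (v \<bullet> v) \<le> v \<bullet> (D2phi t0 x0 *v v)" for v
  proof -
    have "0 \<le> (g'' \<rho> - g' \<rho> / \<rho>) * ((x0 \<bullet> v) / \<rho>)\<^sup>2"
      using g'' \<open>\<rho> > 0\<close> by simp
    then show ?thesis
      using touching(2)[of v] unfolding mult_1 by linarith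
  qed
  then have "real k * (g' \<rho> / \<rho>) \<le> Pk_minus k (D2phi t0 x0)"
    using Pk_minus_ge[OF C12_test_hessian_symmetric[OF C \<open>0 < t0\<close>] \<open>k \<le> CARD('n)\<close>] by blast
  then show "phit t0 x0 \<le> Pk_minus k (D2phi t0 x0)"
    using touching(1) by simp
qed

lemma radial_profile_viscosity_supersolution:
  fixes g :: "real \<Rightarrow> real"
  assumes g: "\<forall>s>0. (g has_real_derivative g' s) (at s) \<and> (g' has_real_derivative g'' s) (at s)"
    and "0 < k" "k < CARD('n)"
  shows "viscosity_supersolution k (radial_profile k g :: real \<Rightarrow> real^'n \<Rightarrow> real)"
  unfolding viscosity_supersolution_def
proof (intro allI impI, elim conjE)
  fix t0 x0 and phi :: "real \<Rightarrow> real^'n \<Rightarrow> real" and phit Dphi D2phi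
  assume "0 < t0" and C: "C12_test phi phit Dphi D2phi"
    and "local_min_at (\<lambda>s y. radial_profile k g s y - phi s y) t0 x0"
  then have max: "local_max_at (\<lambda>s y. (-1) * (radial_profile k g s y - phi s y)) t0 x0"
    by (simp add: local_min_at_iff_local_max_at_uminus)
  define \<rho> where "\<rho> = sqrt (2 * real k * t0 + (norm x0)\<^sup>2)"
  note touching = radial_profile_touching[OF g \<open>0 < k\<close> \<open>0 < t0\<close> C neg_one_neq_zero max, folded \<rho>_def]
  have "v \<bullet> (D2phi t0 x0 *v v) \<le> (g' \<rho> / \<rho>) * (v \<bullet> v)" if "v \<bullet> x0 = 0" for v
    using touching(2)[of v] that by (simp add: inner_commute)
  then have "Pk_minus k (D2phi t0 x0) \<le> real k * (g' \<rho> / \<rho>)"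
    using Pk_minus_le[OF C12_test_hessian_symmetric[OF C \<open>0 < t0\<close>] \<open>k < CARD('n)\<close>] by blast
  then show "Pk_minus k (D2phi t0 x0) \<le> phit t0 x0"
    using touching(1) by simp
qed

theorem mainTheorem1:
  fixes g :: "real \<Rightarrow> real" and k :: nat
  assumes "CARD('n) \<ge> 2" and "1 \<le> k" and "k < CARD('n)"
    and "\<exists>g' g''. \<forall>s>0. (g has_real_derivative g' s) (at s) \<and>
              (g' has_real_derivative g'' s) (at s) \<and> g'' s - g' s / s \<ge> 0"
  shows "viscosity_solution k (\<lambda>t (x::real^'n). g (sqrt (2 * real k * t + (norm x)\<^sup>2)))
         \<and> (\<forall>x::real^'n. g (sqrt (2 * real k * 0 + (norm x)\<^sup>2)) = g (norm x))"
proof -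
  obtain g' g'' where g: "\<forall>s>0. (g has_real_derivative g' s) (at s) \<and> (g' has_real_derivative g'' s) (at s)"
    and g'': "\<forall>s>0. g' s / s \<le> g'' s"
    using assms(4) by force
  have k: "0 < k" "k \<le> CARD('n)"
    using assms(2,3) by simp_all
  have "viscosity_solution k (radial_profile k g :: real \<Rightarrow> real^'n \<Rightarrow> real)"
    unfolding viscosity_solution_def
    using continuous_on_radial_profile[OF _ k(1)] g DERIV_isCont
      radial_profile_viscosity_subsolution[OF g g'' k] radial_profile_viscosity_supersolution[OF g k(1) assms(3)]
    by blast
  then show ?thesis
    by (simp add: radial_profile_def[abs_def])
qed

end
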